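(* The spectral representation formula for reflected Brownian motion, i.e. the identity $$\frac{1}{2}\frac{1}{\sqrt{2\pi t}}\sum_{n=-\infty}^{\infty}\left(e^{-\frac{(x-y+4n)^2}{2t}}+e^{-\frac{(x+y+4n+2)^2}{2t}}\right)=\frac12\left(\frac12+\sum_{n=1}^{\infty}e^{-\frac{n^2\pi^2}{8}t}\cos\left(\frac{n\pi(x+1)}{2}\right)\cos\left(\frac{n\pi(y+1)}{2}\right)\right)$$ for all $x,y\in\mathbb{R}$ and $t>0$, implies the third modular identity: for all $t>0$ and $z\in\mathbb{C}$, $$\sqrt{t}\sum_{n\in\mathbb{Z}}e^{-\pi n^2t}\cos(2nz)=e^{-\frac{z^2}{\pi t}}\sum_{n\in\mathbb{Z}}e^{-\frac{\pi n^2}{t}}\cosh\left(2n\frac{z}{t}\right)=\sum_{n\in\mathbb{Z}}e^{-\frac{(z+\pi n)^2}{\pi t}}.$$ *)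

theory Defs
  imports "HOL-Analysis.Analysis"
begin

end

theory Submission
  imports Defs "HOL-Complex_Analysis.Complex_Analysis"
begin

text \<open>
  With \<open>\<theta>(a, w) = \<Sum>n. exp (2 n w - \<pi> a n\<^sup>2)\<close>, summed over the integers, all three series are values of
  \<open>\<theta>\<close>: replacing \<open>n\<close> by \<open>- n\<close> and averaging turns the exponentials into \<open>cosh\<close> or \<open>cos\<close>, and
  completing the square gives the Gaussian series. The claim becomes
  \<open>sqrt t * \<theta>(t, \<i> z) = exp (- z\<^sup>2 / (\<pi> t)) * \<theta>(1 / t, z / t)\<close>. For real \<open>z\<close> this is the spectral
  representation at \<open>y = - 1\<close>, \<open>x = 4 z / \<pi> - 1\<close> and time \<open>8 t / \<pi>\<close>. Both sides are entire in \<open>z\<close>,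
  since the series converge locally uniformly, so the identity extends from the real line.
\<close>

section \<open>Even functions summed over the integers\<close>

lemma UNIV_int_eq_nat_parts:
  "(UNIV :: int set) = {0} \<union> int ` {1..} \<union> (\<lambda>n. - int n) ` {1..}"
proof -
  have "k \<in> {0} \<union> int ` {1..} \<union> (\<lambda>n. - int n) ` {1..}" for k :: int
    by (cases k rule: int_cases3) (auto simp: image_iff Suc_le_eq)
  then show ?thesis by blast
qed

text \<open>The integers split into 0, the positives and their reflections, and evenness gives both
  halves the same sum.\<close>

lemma has_sum_int_even:
  fixes f :: "int \<Rightarrow> 'a :: real_normed_algebra_1"
  assumes f: "((\<lambda>n. f (int n)) has_sum s) {1..}" and even: "\<And>n. f (- n) = f n"
  shows "(f has_sum (f 0 + 2 * s)) UNIV"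
proof -
  have pos: "(f has_sum s) (int ` {1..})"
    using f by (subst has_sum_reindex) (auto simp: o_def)
  have neg: "(f has_sum s) ((\<lambda>n. - int n) ` {1..})"
    using f by (subst has_sum_reindex) (auto simp: o_def even inj_on_def)
  have "(f has_sum (f 0)) {0}"
    using has_sum_finite[of "{0}" f] by simp
  then have "(f has_sum (f 0 + s + s)) ({0} \<union> int ` {1..} \<union> (\<lambda>n. - int n) ` {1..})"
    by (intro has_sum_Un_disjoint pos neg) auto
  then show ?thesis
    by (simp only: UNIV_int_eq_nat_parts mult_2 add.assoc)
qed

lemma infsum_int_even:
  fixes f :: "int \<Rightarrow> 'a :: {real_normed_algebra_1, banach}"
  assumes "f summable_on UNIV" and "\<And>n. f (- n) = f n"
  shows "infsum f UNIV = f 0 + 2 * (\<Sum>\<^sub>\<infinity>n\<in>{1..}. f (int n))"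
proof -
  have "f summable_on int ` {1..}"
    using assms(1) by (rule summable_on_subset_banach) auto
  then have "(\<lambda>n. f (int n)) summable_on {1..}"
    by (subst (asm) summable_on_reindex) (auto simp: o_def)
  then show ?thesis
    by (intro infsumI has_sum_int_even has_sum_infsum assms(2))
qed

text \<open>This is the majorant for every theta series below; its positive half is geometric with
  ratio \<open>exp (- 1)\<close>.\<close>

lemma summable_on_exp_minus_abs_int:
  "(\<lambda>n::int. exp (- \<bar>of_int n\<bar>) :: real) summable_on UNIV"
proof -
  have "summable (\<lambda>n. exp (- 1 :: real) ^ n)"
    by (intro summable_geometric) auto
  then have "summable (\<lambda>n. exp (- real n))"
    by (simp add: exp_of_nat_mult[symmetric])
  then have "(\<lambda>n. exp (- real n)) summable_on UNIV"
    by (intro summable_nonneg_imp_summable_on) auto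
  then have "(\<lambda>n. exp (- real n)) summable_on {1..}"
    by (rule summable_on_subset_banach) auto
  then have "((\<lambda>n. exp (- \<bar>of_int (int n)\<bar>)) has_sum (\<Sum>\<^sub>\<infinity>n\<in>{1..}. exp (- real n))) {1..}"
    by (simp add: has_sum_infsum)
  then show ?thesis
    by (rule has_sum_imp_summable[OF has_sum_int_even]) simp
qed

section \<open>The theta series: majorant and holomorphy\<close>

definition theta_term :: "real \<Rightarrow> int \<Rightarrow> complex \<Rightarrow> complex" where
  "theta_term a n w = exp (2 * of_int n * w - of_real (pi * a) * (of_int n)\<^sup>2)"

text \<open>At \<open>w = \<i> * z\<close> this is Jacobi's third theta function of \<open>z\<close>
  with nome \<open>exp (- pi * a)\<close>.\<close>

definition theta :: "real \<Rightarrow> complex \<Rightarrow> complex" where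
  "theta a w = (\<Sum>\<^sub>\<infinity>n. theta_term a n w)"

text \<open>The Gaussian decay in \<open>n\<close> beats the linear growth, uniformly for
  \<open>w\<close> in a disc, which is what the Weierstrass M-test needs.\<close>

lemma norm_theta_term_le:
  assumes "a > 0" and "norm w \<le> R"
  shows "norm (theta_term a n w) \<le> exp ((2 * R + 1)\<^sup>2 / (4 * pi * a)) * exp (- \<bar>of_int n\<bar>)"
proof -
  define m c where "m = \<bar>real_of_int n\<bar>" and "c = pi * a"
  have "c > 0" using assms by (simp add: c_def)
  have "real_of_int n * Re w \<le> m * norm w"
    unfolding m_def by (metis abs_ge_self abs_mult abs_Re_le_cmod abs_ge_zero mult_left_mono order_trans)
  also have "\<dots> \<le> m * R" using assms by (intro mult_left_mono) (auto simp: m_def)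
  finally have 1: "real_of_int n * Re w \<le> m * R" .
  \<comment> \<open>The square is completed with linear coefficient \<open>2 * R + 1\<close> rather
    than \<open>2 * R\<close>, so that \<open>- m\<close> is left over for the majorant.\<close>
  have "0 \<le> (2 * c * m - (2 * R + 1))\<^sup>2 / (4 * c)"
    using \<open>c > 0\<close> by simp
  also have "\<dots> = c * m\<^sup>2 - (2 * R + 1) * m + (2 * R + 1)\<^sup>2 / (4 * c)"
    using \<open>c > 0\<close> by (simp add: field_simps power2_eq_square)
  finally have 2: "2 * (m * R) - c * m\<^sup>2 \<le> (2 * R + 1)\<^sup>2 / (4 * c) - m"
    by (simp add: algebra_simps)
  have re: "Re (2 * of_int n * w - of_real c * (of_int n)\<^sup>2) = 2 * (real_of_int n * Re w) - c * m\<^sup>2"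
    by (simp add: m_def power2_eq_square)
  show ?thesis
    using 1 2 unfolding theta_term_def norm_exp_eq_Re c_def[symmetric] re exp_add[symmetric]
    by (simp add: m_def c_def mult.assoc)
qed

lemma summable_on_cmult_exp_minus_abs_int:
  "(\<lambda>n::int. c * exp (- \<bar>of_int n\<bar>) :: real) summable_on UNIV"
  by (intro summable_on_cmult_right summable_on_exp_minus_abs_int)

lemma theta_has_sum:
  assumes "a > 0"
  shows "((\<lambda>n. theta_term a n w) has_sum theta a w) UNIV"
proof -
  have "(\<lambda>n. norm (theta_term a n w)) summable_on UNIV"
    using norm_theta_term_le[OF assms order_refl]
    by (rule Infinite_Sum.abs_summable_on_comparison_test'[OF summable_on_cmult_exp_minus_abs_int])
  then show ?thesis
    unfolding theta_def by (rule has_sum_infsum[OF abs_summable_summable])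
qed

lemma holomorphic_theta:
  assumes "a > 0"
  shows "theta a holomorphic_on UNIV"
proof -
  have "theta a holomorphic_on ball 0 R" for R
  proof (rule holomorphic_uniform_limit[of 0 R "\<lambda>X w. \<Sum>n\<in>X. theta_term a n w"
          "finite_subsets_at_top UNIV" "theta a"])
    show "uniform_limit (cball 0 R) (\<lambda>X w. \<Sum>n\<in>X. theta_term a n w) (theta a)
            (finite_subsets_at_top UNIV)"
      using norm_theta_term_le[OF assms, of _ R] theta_has_sum[OF assms] summable_on_cmult_exp_minus_abs_int
      by (intro Weierstrass_m_test_general') auto
  qed (auto simp: theta_term_def intro!: always_eventually holomorphic_intros continuous_intros)
  then have "theta a field_differentiable at z" for z
    by (rule holomorphic_on_imp_differentiable_at[of _ "ball 0 (norm z + 1)"]) auto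
  then show ?thesis
    by (simp add: holomorphic_on_def field_differentiable_at_within)
qed

section \<open>The three series as values of theta\<close>

lemma theta_has_sum_uminus:
  assumes "a > 0"
  shows "((\<lambda>n. theta_term a n (- w)) has_sum theta a w) UNIV"
proof -
  have "bij (uminus :: int \<Rightarrow> int)"
    by (rule bij_uminus)
  from has_sum_reindex_bij_betw[OF this, of "\<lambda>n. theta_term a n w"] show ?thesis
    using theta_has_sum[OF assms, of w] by (simp add: theta_term_def)
qed

lemma theta_has_sum_cosh:
  assumes "a > 0"
  shows "((\<lambda>n. exp (- (of_real (pi * a) * (of_int n)\<^sup>2)) * cosh (2 * of_int n * w))
           has_sum theta a w) UNIV"
proof -
  have "exp (- (of_real (pi * a) * (of_int n)\<^sup>2)) * cosh (2 * of_int n * w)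
      = (theta_term a n w + theta_term a n (- w)) / 2" for n
    by (simp add: theta_term_def cosh_field_def exp_diff exp_minus field_simps)
  then show ?thesis
    using has_sum_add[OF theta_has_sum[OF assms, of w] theta_has_sum_uminus[OF assms, of w],
        THEN has_sum_divide_const[where c = 2]]
    by (simp only: mult_2[symmetric]) simp
qed

lemma theta_has_sum_cos:
  assumes "a > 0"
  shows "((\<lambda>n. exp (- (of_real pi * (of_int n)\<^sup>2 * of_real a)) * cos (2 * of_int n * z))
           has_sum theta a (\<i> * z)) UNIV"
proof -
  \<comment> \<open>\<open>cosh_conv_cos\<close> multiplies the argument by \<open>\<i>\<close> once
    more; the resulting sign is absorbed because \<open>cos\<close> is even.\<close>
  have "\<i> * (2 * of_int n * (\<i> * z)) = - (2 * of_int n * z)" for n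
    by (simp add: complex_eq_iff)
  then have "cosh (2 * of_int n * (\<i> * z)) = cos (2 * of_int n * z)" for n
    by (simp only: cosh_conv_cos cos_minus)
  moreover have "of_real (pi * a) * (of_int n)\<^sup>2 = (of_real pi * (of_int n)\<^sup>2 * of_real a :: complex)"
    for n
    by simp
  ultimately show ?thesis
    using theta_has_sum_cosh[OF assms, of "\<i> * z"] by (simp only:)
qed

text \<open>Expanding the square gives the linear term \<open>- 2 * n * z / t\<close>, so the terms
  are those of theta at \<open>- z / t\<close>; the reflected sum applies.\<close>

lemma theta_has_sum_gaussian:
  assumes "t > 0"
  shows "((\<lambda>n. exp (- ((z + of_real pi * of_int n)\<^sup>2 / (of_real pi * of_real t))))
           has_sum (exp (- (z\<^sup>2 / (of_real pi * of_real t))) * theta (1 / t) (z / of_real t))) UNIV"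
proof -
  have "- ((z + of_real pi * of_int n)\<^sup>2 / (of_real pi * of_real t))
      = - (z\<^sup>2 / (of_real pi * of_real t))
        + (2 * of_int n * (- (z / of_real t)) - of_real (pi * (1 / t)) * (of_int n)\<^sup>2)" for n
    using assms by (simp add: field_simps power2_eq_square)
  then have "exp (- ((z + of_real pi * of_int n)\<^sup>2 / (of_real pi * of_real t)))
      = exp (- (z\<^sup>2 / (of_real pi * of_real t))) * theta_term (1 / t) n (- (z / of_real t))" for n
    by (simp only: theta_term_def exp_add)
  then show ?thesis
    using has_sum_cmult_right[OF theta_has_sum_uminus[of "1 / t" "z / of_real t"]] assms
    by (simp only: zero_less_divide_1_iff)
qed

section \<open>Extension from the real line to the complex plane\<close>

lemma theta_modular_of_real:
  assumes "t > 0"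
    and real: "\<And>x::real. of_real (sqrt t) * theta t (\<i> * of_real x)
      = exp (- ((of_real x)\<^sup>2 / (of_real pi * of_real t))) * theta (1 / t) (of_real x / of_real t)"
  shows "of_real (sqrt t) * theta t (\<i> * z)
      = exp (- (z\<^sup>2 / (of_real pi * of_real t))) * theta (1 / t) (z / of_real t)"
proof -
  define h where "h z = of_real (sqrt t) * theta t (\<i> * z)
      - exp (- (z\<^sup>2 / (of_real pi * of_real t))) * theta (1 / t) (z / of_real t)" for z
  have comp: "(\<lambda>z. theta a (g z)) holomorphic_on UNIV" if "a > 0" "g holomorphic_on UNIV" for a g
    using holomorphic_on_compose_gen[OF that(2) holomorphic_theta[OF that(1)]] by (simp add: o_def)
  have "h holomorphic_on UNIV"
    unfolding h_def using assms(1) by (intro holomorphic_intros comp) auto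
  \<comment> \<open>The identity theorem asks only for zeros of \<open>h\<close> accumulating at one
    point; the reals accumulate at 0.\<close>
  moreover have "(0::complex) islimpt \<real>"
    unfolding islimpt_approachable
  proof (intro allI impI)
    fix e :: real assume "e > 0"
    then show "\<exists>x'\<in>\<real>. x' \<noteq> 0 \<and> dist x' (0::complex) < e"
      by (intro bexI[of _ "of_real (e / 2)"]) (auto simp: norm_divide simp del: of_real_divide)
  qed
  moreover have "h w = 0" if "w \<in> \<real>" for w
    using that real by (auto simp: h_def Reals_def)
  ultimately have "h z = 0"
    by (rule analytic_continuation[OF _ open_UNIV connected_UNIV subset_UNIV UNIV_I _ _ UNIV_I])
  then show ?thesis by (simp add: h_def)
qed

theorem theorem4p4:
  assumes spectral_representation:
    "\<And>(x::real) (y::real) (t::real). t > 0 \<Longrightarrow>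
       (1 / 2) * (1 / sqrt (2 * pi * t)) *
         (\<Sum>\<^sub>\<infinity>n\<in>(UNIV::int set).
            exp (- ((x - y + 4 * of_int n)\<^sup>2 / (2 * t))) +
            exp (- ((x + y + 4 * of_int n + 2)\<^sup>2 / (2 * t))))
       = (1 / 2) * (1 / 2 +
         (\<Sum>\<^sub>\<infinity>n\<in>{1::nat..}.
            exp (- ((of_nat n)\<^sup>2 * pi\<^sup>2 / 8) * t) *
            cos (of_nat n * pi * (x + 1) / 2) * cos (of_nat n * pi * (y + 1) / 2)))"
  shows "\<forall>t::real. t > 0 \<longrightarrow> (\<forall>z::complex.
       (\<lambda>n::int. exp (- (of_real pi * (of_int n)\<^sup>2 * of_real t)) * cos (2 * of_int n * z))
         summable_on UNIV \<and>
       (\<lambda>n::int. exp (- (of_real pi * (of_int n)\<^sup>2 / of_real t)) *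
                 cosh (2 * of_int n * (z / of_real t))) summable_on UNIV \<and>
       (\<lambda>n::int. exp (- ((z + of_real pi * of_int n)\<^sup>2 / (of_real pi * of_real t))))
         summable_on UNIV \<and>
       of_real (sqrt t) *
         (\<Sum>\<^sub>\<infinity>n\<in>(UNIV::int set).
            exp (- (of_real pi * (of_int n)\<^sup>2 * of_real t)) * cos (2 * of_int n * z))
       = exp (- (z\<^sup>2 / (of_real pi * of_real t))) *
         (\<Sum>\<^sub>\<infinity>n\<in>(UNIV::int set).
            exp (- (of_real pi * (of_int n)\<^sup>2 / of_real t)) *
            cosh (2 * of_int n * (z / of_real t))) \<and>
       exp (- (z\<^sup>2 / (of_real pi * of_real t))) *
         (\<Sum>\<^sub>\<infinity>n\<in>(UNIV::int set).
            exp (- (of_real pi * (of_int n)\<^sup>2 / of_real t)) *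
            cosh (2 * of_int n * (z / of_real t)))
       = (\<Sum>\<^sub>\<infinity>n\<in>(UNIV::int set).
            exp (- ((z + of_real pi * of_int n)\<^sup>2 / (of_real pi * of_real t)))))"
proof -
  have real: "of_real (sqrt t) * theta t (\<i> * of_real x)
      = exp (- ((of_real x)\<^sup>2 / (of_real pi * of_real t))) * theta (1 / t) (of_real x / of_real t)"
    if t: "t > 0" for t x :: real
  proof -
    \<comment> \<open>The hypothesis concerns real series, so the Gaussian and cosine series at real
      \<open>x\<close> are first recast as real ones.\<close>
    define G where "G n = exp (- ((x + pi * of_int n)\<^sup>2 / (pi * t)))" for n :: int
    define C where "C n = exp (- (pi * (of_int n)\<^sup>2 * t)) * cos (2 * of_int n * x)" for n :: int
    have G_of_real: "(\<lambda>n. exp (- ((of_real x + of_real pi * of_int n)\<^sup>2 / (of_real pi * of_real t))))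
        = (\<lambda>n. complex_of_real (G n))"
      by (simp add: G_def flip: exp_of_real)
    have C_of_real: "(\<lambda>n. exp (- (of_real pi * (of_int n)\<^sup>2 * of_real t)) * cos (2 * of_int n * of_real x))
        = (\<lambda>n. complex_of_real (C n))"
      by (simp add: C_def flip: exp_of_real cos_of_real)
    note G_sum = theta_has_sum_gaussian[OF t, of "of_real x", unfolded G_of_real]
    note C_sum = theta_has_sum_cos[OF t, of "of_real x", unfolded C_of_real]
    have G: "G summable_on UNIV" and C: "C summable_on UNIV"
      using has_sum_Re[OF G_sum] has_sum_Re[OF C_sum] by (auto dest: has_sum_imp_summable)
    \<comment> \<open>The central term \<open>C 0 = 1\<close> will account for the constant
      \<open>1 / 2\<close> of the spectral expansion.\<close>
    have C_even: "infsum C UNIV = 1 + 2 * (\<Sum>\<^sub>\<infinity>n\<in>{1..}. C (int n))"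
      by (subst infsum_int_even[OF C]) (auto simp: C_def)
    \<comment> \<open>The time \<open>s\<close> solves \<open>pi\<^sup>2 * s / 8 = pi * t\<close>,
      matching the decay rates, and \<open>u\<close> solves \<open>pi * (u + 1) / 2 = 2 * x\<close>,
      matching the frequencies.\<close>
    define s where "s = 8 * t / pi"
    have s: "s > 0" using t by (simp add: s_def)
    define u where "u = 4 * x / pi - 1"
    \<comment> \<open>For \<open>y = - 1\<close> the two families of images coincide and the second cosine is 1.\<close>
    have "(u - (- 1) + 4 * of_int n)\<^sup>2 / (2 * s) = (x + pi * of_int n)\<^sup>2 / (pi * t)" for n :: int
      using t by (simp add: u_def s_def field_simps power2_eq_square)
    moreover have "(u + (- 1) + 4 * of_int n + 2)\<^sup>2 / (2 * s) = (x + pi * of_int n)\<^sup>2 / (pi * t)"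
      for n :: int
      using t by (simp add: u_def s_def field_simps power2_eq_square)
    ultimately have lhs: "(\<Sum>\<^sub>\<infinity>n\<in>(UNIV::int set).
            exp (- ((u - (- 1) + 4 * of_int n)\<^sup>2 / (2 * s))) +
            exp (- ((u + (- 1) + 4 * of_int n + 2)\<^sup>2 / (2 * s)))) = 2 * infsum G UNIV"
      using infsum_add[OF G G] by (simp only: G_def mult_2)
    have rhs: "exp (- ((of_nat n)\<^sup>2 * pi\<^sup>2 / 8) * s) *
            cos (of_nat n * pi * (u + 1) / 2) * cos (of_nat n * pi * (- 1 + 1) / 2) = C (int n)"
      for n :: nat
      by (simp add: C_def u_def s_def power2_eq_square mult_ac)
    have "sqrt (2 * pi * s) = 4 * sqrt t"
      by (simp add: s_def real_sqrt_mult)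
    then have "(1 / 2) * (1 / (4 * sqrt t)) * (2 * infsum G UNIV)
        = (1 / 2) * (1 / 2 + (\<Sum>\<^sub>\<infinity>n\<in>{1..}. C (int n)))"
      using spectral_representation[OF s, of u "- 1", unfolded lhs rhs] by simp
    \<comment> \<open>The left side is \<open>infsum G UNIV / (4 * sqrt t)\<close>, and by
      \<open>C_even\<close> the right side is \<open>infsum C UNIV / 4\<close>.\<close>
    then have "sqrt t * infsum C UNIV = infsum G UNIV"
      using t unfolding C_even by (simp add: field_simps)
    moreover have "theta t (\<i> * of_real x) = of_real (infsum C UNIV)"
      using C_sum has_sum_of_real[OF has_sum_infsum[OF C]] by (rule has_sum_unique)
    moreover have "exp (- ((of_real x)\<^sup>2 / (of_real pi * of_real t))) * theta (1 / t) (of_real x / of_real t)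
        = of_real (infsum G UNIV)"
      using G_sum has_sum_of_real[OF has_sum_infsum[OF G]] by (rule has_sum_unique)
    ultimately show ?thesis
      by (simp flip: of_real_mult)
  qed
  have cosh_sum: "((\<lambda>n. exp (- (of_real pi * (of_int n)\<^sup>2 / of_real t)) *
      cosh (2 * of_int n * (z / of_real t))) has_sum theta (1 / t) (z / of_real t)) UNIV"
    if "t > 0" for t z
    using theta_has_sum_cosh[of "1 / t" "z / of_real t"] that by simp
  note sums = theta_has_sum_cos cosh_sum theta_has_sum_gaussian
  show ?thesis
    \<comment> \<open>Once each sum is replaced by its theta value, the first equality is the
      modular identity and the second has identical sides.\<close>
    by (intro allI impI conjI)
      (simp_all only: sums[THEN infsumI] sums[THEN has_sum_imp_summable] theta_modular_of_real[OF _ real])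
qed

end
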